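(* Let $A$ and $B$ be daisy cubes whose $\tau$-graphs $A^{\tau}$ and $B^{\tau}$ are forests. Let $\{\mathcal{E}_1, \ldots, \mathcal{E}_n\}$ and $\{\mathcal{F}_1, \ldots, \mathcal{F}_n\}$ be the sets of $\Theta$-classes of $A$ and $B$, respectively. If $\Upsilon: A^{\tau} \rightarrow B^{\tau}$ is a graph isomorphism such that $\Upsilon(\mathcal{E}_i)=\mathcal{F}_i$ for all $i \in \{1, \ldots, n\}$, then there exists a graph isomorphism $\lambda: A \rightarrow B$ such that, for every $i \in \{1, \ldots, n\}$, $uv \in \mathcal{E}_i$ if and only if $\lambda(u)\lambda(v) \in \mathcal{F}_i$. Moreover, the restriction of $\lambda$ to $A/\mathcal{E}_j$ is an isomorphism between $A/\mathcal{E}_j$ and $B/\mathcal{F}_j$ for every $j \in \{1, \ldots, n\}$.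
   Context: All graphs are simple. For a positive integer $h$, let $\mathcal{B}^h$ be the set of binary strings of length $h$, partially ordered by $u_1\ldots u_h \le v_1\ldots v_h$ iff $u_i\le v_i$ for all $i$. The hypercube $Q_h$ has vertex set $\mathcal{B}^h$, two strings being adjacent iff they differ in exactly one position; $Q_0$ is the one-vertex graph. For $X\subseteq \mathcal{B}^h$ (nonempty), the daisy cube generated by $X$ is the subgraph $Q_h(X)$ of $Q_h$ induced by $\{u\in\mathcal{B}^h : u\le x \text{ for some } x\in X\}$; its minimum vertex is $0^h$. A daisy cube is a graph (isomorphic to one) of this form. Daisy cubes are partial cubes, i.e. isometric subgraphs of hypercubes. For a connected graph $G$ with distance $d_G$, two edges $x_1x_2$ and $y_1y_2$ are in the Djoković–Winkler relation $\Theta$ if $d_G(x_1,y_1)+d_G(x_2,y_2)\ne d_G(x_1,y_2)+d_G(x_2,y_1)$. On a partial cube $\Theta$ is an equivalence relation on the edge set; its classes are the $\Theta$-classes. The $\tau$-graph $H^\tau$ of a partial cube $H$ is the graph whose vertices are the $\Theta$-classes of $H$, with two distinct $\Theta$-classes $\mathcal{E},\mathcal{F}$ adjacent iff there are edges $uv\in\mathcal{E}$ and $vw\in\mathcal{F}$ of $H$ such that $uvw$ is a convex path on three vertices, i.e. $u,w$ are nonadjacent and $v$ is their only common neighbor. A forest may have no edges. For a partial cube $G$ and an edge $ab$, let $W_{ab}$ be the set of vertices of $G$ closer to $a$ than to $b$, and let $U_{ab}$ be the set of vertices of $W_{ab}$ having a neighbor in $W_{ba}$. If $\mathcal{E}$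 is the $\Theta$-class of $ab$, then $G-\mathcal{E}$ (deleting the edges of $\mathcal{E}$) has exactly the two components induced by $W_{ab}$ and $W_{ba}$. The contraction $G/\mathcal{E}$ is the graph obtained from $G$ by contracting the edges of $\mathcal{E}$. In a daisy cube every $\Theta$-class $\mathcal{E}$ is peripheral, i.e. $ab\in\mathcal{E}$ can be labelled so that $W_{ba}=U_{ba}$, and then $G/\mathcal{E}$ is identified with the induced subgraph of $G$ on $W_{ab}$; this is the component of $G-\mathcal{E}$ containing the minimum vertex (and if both components qualify, the one containing the minimum vertex is taken). *)

theory Defs
  imports Main
begin

section \<open>Simple graphs\<close>

record 'a sgraph =
  verts :: "'a set"
  edges :: "'a set set"

definition simple_graph :: "'a sgraph \<Rightarrow> bool" where
  "simple_graph G \<longleftrightarrow>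
     (\<forall>e\<in>edges G. \<exists>u\<in>verts G. \<exists>v\<in>verts G. u \<noteq> v \<and> e = {u, v})"

definition adj :: "'a sgraph \<Rightarrow> 'a \<Rightarrow> 'a \<Rightarrow> bool" where
  "adj G u v \<longleftrightarrow> {u, v} \<in> edges G"

definition induced :: "'a sgraph \<Rightarrow> 'a set \<Rightarrow> 'a sgraph" where
  "induced G S = \<lparr>verts = verts G \<inter> S, edges = {e \<in> edges G. e \<subseteq> S}\<rparr>"

text \<open>Only the values of \<open>f\<close> on the vertices of \<open>G\<close> matter, so for a subgraph \<open>H\<close> the proposition
  \<open>graph_iso f H K\<close> is a statement about the restriction of \<open>f\<close> to \<open>H\<close>.\<close>

definition graph_iso :: "('a \<Rightarrow> 'b) \<Rightarrow> 'a sgraph \<Rightarrow> 'b sgraph \<Rightarrow> bool" where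
  "graph_iso f G H \<longleftrightarrow>
     bij_betw f (verts G) (verts H) \<and>
     (\<forall>u\<in>verts G. \<forall>v\<in>verts G. adj G u v \<longleftrightarrow> adj H (f u) (f v))"

definition forest :: "'a sgraph \<Rightarrow> bool" where
  "forest G \<longleftrightarrow>
     \<not> (\<exists>c. 3 \<le> length c \<and> distinct c \<and> successively (adj G) c \<and> adj G (last c) (hd c))"

text \<open>The distance is the least length of a walk; its value is only meaningful for two vertices in
  the same connected component. All graphs to which it is applied below are connected.\<close>

definition gdist :: "'a sgraph \<Rightarrow> 'a \<Rightarrow> 'a \<Rightarrow> nat" where
  "gdist G u v = (LEAST n. (adj G ^^ n) u v)"


section \<open>Daisy cubes\<close>

text \<open>Binary strings are Boolean lists, with \<open>False\<close> for 0 and \<open>True\<close> for 1.\<close>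

definition binary_strings :: "nat \<Rightarrow> bool list set" where
  "binary_strings h = {u. length u = h}"

definition hypercube :: "nat \<Rightarrow> bool list sgraph" where
  "hypercube h =
     \<lparr>verts = binary_strings h,
      edges = {{u, v} | u v. u \<in> binary_strings h \<and> v \<in> binary_strings h \<and>
                             card {i. i < h \<and> u ! i \<noteq> v ! i} = 1}\<rparr>"

definition daisy :: "nat \<Rightarrow> bool list set \<Rightarrow> bool list sgraph" where
  "daisy h X = induced (hypercube h) {u. \<exists>x\<in>X. list_all2 (\<le>) u x}"

text \<open>A graph is a daisy cube if it is isomorphic to some \<open>daisy h X\<close>. The isomorphism determines
  which vertex plays the role of the minimum vertex \<open>0\<^sup>h\<close>. Since an abstract graph may
  admit several such choices, the minimum vertex \<open>m\<close> is part of the data.\<close>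

definition daisy_cube_with_min :: "'a sgraph \<Rightarrow> 'a \<Rightarrow> bool" where
  "daisy_cube_with_min G m \<longleftrightarrow>
     simple_graph G \<and>
     (\<exists>h X f. 0 < h \<and> X \<noteq> {} \<and> X \<subseteq> binary_strings h \<and>
              graph_iso f (daisy h X) G \<and> m = f (replicate h False))"


section \<open>Theta-classes, tau-graphs and contractions\<close>

definition Theta :: "'a sgraph \<Rightarrow> ('a set \<times> 'a set) set" where
  "Theta G =
     {(e, f). e \<in> edges G \<and> f \<in> edges G \<and>
        (\<exists>x\<^sub>1 x\<^sub>2 y\<^sub>1 y\<^sub>2. e = {x\<^sub>1, x\<^sub>2} \<and> f = {y\<^sub>1, y\<^sub>2} \<and>
           gdist G x\<^sub>1 y\<^sub>1 + gdist G x\<^sub>2 y\<^sub>2 \<noteq> gdist G x\<^sub>1 y\<^sub>2 + gdist G x\<^sub>2 y\<^sub>1)}"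

definition Theta_classes :: "'a sgraph \<Rightarrow> 'a set set set" where
  "Theta_classes G = edges G // Theta G"

definition convex_path3 :: "'a sgraph \<Rightarrow> 'a \<Rightarrow> 'a \<Rightarrow> 'a \<Rightarrow> bool" where
  "convex_path3 G u v w \<longleftrightarrow>
     u \<noteq> w \<and> \<not> adj G u w \<and> {x. adj G u x \<and> adj G x w} = {v}"

definition tau_graph :: "'a sgraph \<Rightarrow> 'a set set sgraph" where
  "tau_graph G =
     \<lparr>verts = Theta_classes G,
      edges = {{E, F} | E F. E \<in> Theta_classes G \<and> F \<in> Theta_classes G \<and> E \<noteq> F \<and>
                 (\<exists>u v w. {u, v} \<in> E \<and> {v, w} \<in> F \<and> convex_path3 G u v w)}\<rparr>"

definition W_set :: "'a sgraph \<Rightarrow> 'a \<Rightarrow> 'a \<Rightarrow> 'a set" where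
  "W_set G a b = {v \<in> verts G. gdist G v a < gdist G v b}"

definition U_set :: "'a sgraph \<Rightarrow> 'a \<Rightarrow> 'a \<Rightarrow> 'a set" where
  "U_set G a b = {v \<in> W_set G a b. \<exists>w \<in> W_set G b a. adj G v w}"

text \<open>The contraction \<open>G/E\<close> of a peripheral Theta-class \<open>E\<close> in a daisy cube \<open>G\<close> with minimum vertex
  \<open>m\<close>. Contracting the edges of \<open>E\<close> merges every vertex of the peripheral side \<open>W\<^sub>b\<^sub>a = U\<^sub>b\<^sub>a\<close> into its
  neighbour in \<open>W\<^sub>a\<^sub>b\<close>, so \<open>G/E\<close> is identified with the subgraph of \<open>G\<close> induced by \<open>W\<^sub>a\<^sub>b\<close>; the
  labelling is the one for which \<open>W\<^sub>a\<^sub>b\<close> contains \<open>m\<close>. The resulting graph does not depend on the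
  choice of the edge \<open>ab\<close> in \<open>E\<close>.\<close>

definition contraction :: "'a sgraph \<Rightarrow> 'a \<Rightarrow> 'a set set \<Rightarrow> 'a sgraph" where
  "contraction G m E =
     (THE H. \<exists>a b. {a, b} \<in> E \<and> W_set G b a = U_set G b a \<and> m \<in> W_set G a b \<and>
                   H = induced G (W_set G a b))"

end

theory Submission
  imports Defs
begin

text \<open>
  Read a binary string as the set of positions of its ones. A daisy cube then becomes the family of
  faces of a finite simplicial complex, two faces being adjacent iff they differ in one element.
  Distance is the size of the symmetric difference, so two edges are \<open>\<Theta>\<close>-related iff they add or
  remove the same element: the \<open>\<Theta>\<close>-classes are the points of the complex.

  A convex path on three vertices that changes first the point \<open>i\<close> and then the point \<open>j\<close> must pass
  through a face \<open>v\<close>, avoiding \<open>i\<close> and \<open>j\<close>, for which \<open>v \<union> {i}\<close> and \<open>v \<union> {j}\<close> are faces but \<open>v \<union> {i, j}\<close>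
  is not; otherwise the square could be completed. Hence \<open>i\<close> and \<open>j\<close> are \<open>\<tau>\<close>-adjacent iff some minimal
  nonface contains both, and every minimal nonface is a clique of the \<open>\<tau>\<close>-graph. If the \<open>\<tau>\<close>-graph is
  a forest it has no triangle, so the minimal nonfaces consisting of points are exactly the
  \<open>\<tau>\<close>-edges, and the faces are exactly the independent sets of the \<open>\<tau>\<close>-graph
  (lemma \<open>face_iff_independent\<close>).

  The daisy cube, the directions of its edges and its contractions can thus be read off from the
  \<open>\<tau>\<close>-graph (lemma \<open>independent_set_labelling\<close>), and an isomorphism of \<open>\<tau>\<close>-graphs, applied
  elementwise to independent sets, is the required isomorphism of daisy cubes.
\<close>

section \<open>Graphs labelled by the faces of a simplicial complex\<close>

lemma mem_sym_diff_singleton: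
  assumes "sym_diff P Q = {i}"
  shows "x \<in> P \<longleftrightarrow> (if x = i then x \<notin> Q else x \<in> Q)"
proof -
  have "x \<in> sym_diff P Q \<longleftrightarrow> x = i" using assms by simp
  then show ?thesis by auto
qed

lemma card_sym_diff_flip:
  fixes P Q R :: "'l set"
  assumes "finite P" "finite Q" "sym_diff P Q = {i}" "finite R"
  shows "int (card (sym_diff P R)) =
         int (card (sym_diff Q R)) + (if i \<in> P \<longleftrightarrow> i \<in> R then - 1 else 1)"
proof (cases "i \<in> P \<longleftrightarrow> i \<in> R")
  case True
  then have "sym_diff Q R = insert i (sym_diff P R)" "i \<notin> sym_diff P R"
    by (auto simp: mem_sym_diff_singleton[OF assms(3)] split: if_splits)
  then show ?thesis using True assms by simp
next
  case False
  then have "sym_diff P R = insert i (sym_diff Q R)" "i \<notin> sym_diff Q R"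
    by (auto simp: mem_sym_diff_singleton[OF assms(3)] split: if_splits)
  then show ?thesis using False assms by simp
qed

text \<open>The labelling makes a graph a daisy cube without reference to strings. The vertex \<open>m\<close>, whose label
  is the empty face, is the minimum vertex.\<close>

locale face_labelling =
  fixes G :: "'v sgraph" and s :: "'v \<Rightarrow> 'l set" and m :: 'v
  assumes simple: "simple_graph G"
    and inj: "inj_on s (verts G)"
    and adj_iff: "\<lbrakk>x \<in> verts G; y \<in> verts G\<rbrakk> \<Longrightarrow> adj G x y \<longleftrightarrow> (\<exists>i. sym_diff (s x) (s y) = {i})"
    and subface: "\<lbrakk>x \<in> verts G; T \<subseteq> s x\<rbrakk> \<Longrightarrow> T \<in> s ` verts G"
    and finite_points: "finite (\<Union> (s ` verts G))"
    and min_vertex: "m \<in> verts G" "s m = {}"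
begin

abbreviation faces :: "'l set set" where "faces \<equiv> s ` verts G"

abbreviation points :: "'l set" where "points \<equiv> \<Union> faces"

definition direction :: "'l \<Rightarrow> 'v set set" where
  "direction i = {{x, y} | x y. x \<in> verts G \<and> y \<in> verts G \<and> sym_diff (s x) (s y) = {i}}"

lemma face_subset: "\<lbrakk>T \<in> faces; T' \<subseteq> T\<rbrakk> \<Longrightarrow> T' \<in> faces"
  using subface by blast

lemma finite_label [simp]: "x \<in> verts G \<Longrightarrow> finite (s x)"
  using finite_points by (meson UN_upper finite_subset)

lemma adj_verts: "adj G x y \<Longrightarrow> x \<in> verts G \<and> y \<in> verts G"
  using simple unfolding simple_graph_def adj_def by (metis doubleton_eq_iff)

lemma pair_in_direction:
  assumes "x \<in> verts G" "y \<in> verts G"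
  shows "{x, y} \<in> direction i \<longleftrightarrow> sym_diff (s x) (s y) = {i}"
  using assms unfolding direction_def by (auto simp: doubleton_eq_iff Un_commute)

lemma edges_eq: "edges G = (\<Union>i. direction i)"
proof (intro equalityI subsetI)
  fix e assume e: "e \<in> edges G"
  then obtain x y where "x \<in> verts G" "y \<in> verts G" "e = {x, y}"
    using simple unfolding simple_graph_def by blast
  then show "e \<in> (\<Union>i. direction i)"
    using e adj_iff[of x y] pair_in_direction[of x y] by (auto simp: adj_def)
next
  fix e assume "e \<in> (\<Union>i. direction i)"
  then obtain i x y where "x \<in> verts G" "y \<in> verts G" "e = {x, y}" "sym_diff (s x) (s y) = {i}"
    unfolding direction_def by blast
  then show "e \<in> edges G"
    using adj_iff[of x y] by (auto simp: adj_def)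
qed

lemma direction_disjoint: "\<lbrakk>e \<in> direction i; e \<in> direction j\<rbrakk> \<Longrightarrow> i = j"
  using pair_in_direction unfolding direction_def[of i] by blast

text \<open>If \<open>i\<close> is a point of the complex, the edge from the empty face to \<open>{i}\<close> has direction \<open>i\<close>.\<close>

lemma direction_nonempty_iff: "direction i \<noteq> {} \<longleftrightarrow> i \<in> points"
proof
  assume "direction i \<noteq> {}"
  then show "i \<in> points" unfolding direction_def by blast
next
  assume "i \<in> points"
  then obtain y where "y \<in> verts G" "{i} \<subseteq> s y" by blast
  then have "{i} \<in> faces" by (rule subface)
  then obtain x where x: "x \<in> verts G" "s x = {i}" by (metis imageE)
  then have "{m, x} \<in> direction i"
    using pair_in_direction min_vertex by simp
  then show "direction i \<noteq> {}" by blast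
qed

lemma inj_on_direction: "inj_on direction points"
proof (rule inj_onI)
  fix i j assume "i \<in> points" "direction i = direction j"
  moreover from this obtain e where "e \<in> direction i" using direction_nonempty_iff by blast
  ultimately show "i = j" using direction_disjoint by blast
qed


section \<open>Distance and the relation \<open>\<Theta>\<close>\<close>

text \<open>One step of a walk changes the symmetric difference with a fixed face by a single point.\<close>

lemma walk_length_ge: "(adj G ^^ k) x y \<Longrightarrow> x \<in> verts G \<Longrightarrow> card (sym_diff (s x) (s y)) \<le> k"
proof (induction k arbitrary: y)
  case 0
  then show ?case by simp
next
  case (Suc k)
  then obtain z where z: "(adj G ^^ k) x z" "adj G z y" by auto
  then have v: "z \<in> verts G" "y \<in> verts G" using adj_verts by auto
  obtain i where "sym_diff (s y) (s z) = {i}"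
    using z(2) adj_iff[OF v] by (metis Un_commute)
  then have "int (card (sym_diff (s y) (s x))) \<le> int (card (sym_diff (s z) (s x))) + 1"
    using card_sym_diff_flip[OF finite_label[OF v(2)] finite_label[OF v(1)] _
        finite_label[OF Suc.prems(2)]] by fastforce
  then show ?case using Suc.IH[OF z(1)] Suc.prems(2) by (simp add: Un_commute)
qed

text \<open>The walk first removes the points of \<open>s x - s y\<close> and only then adds those of \<open>s y - s x\<close>: in the
  first phase it visits subsets of \<open>s x\<close>, in the second subsets of \<open>s y\<close>, so it stays inside the
  complex.\<close>

lemma walk_exists:
  "\<lbrakk>x \<in> verts G; y \<in> verts G; card (sym_diff (s x) (s y)) = k\<rbrakk> \<Longrightarrow> (adj G ^^ k) x y"
proof (induction k arbitrary: x)
  case 0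
  then have "s x = s y" by auto
  then show ?case using 0 inj by (auto dest: inj_onD)
next
  case (Suc k)
  obtain i T where T: "T \<in> faces" "sym_diff (s x) T = {i}" "i \<in> s x \<longleftrightarrow> i \<notin> s y"
  proof (cases "s x \<subseteq> s y")
    case True
    moreover have "s x \<noteq> s y" using Suc.prems(3) by auto
    ultimately obtain i where i: "i \<in> s y - s x" by blast
    show ?thesis
    proof (rule that[of _ i])
      show "insert i (s x) \<in> faces"
        by (rule subface[OF Suc.prems(2)]) (use True i in blast)
    qed (use i in auto)
  next
    case False
    then obtain i where i: "i \<in> s x - s y" by blast
    show ?thesis
    proof (rule that[of _ i])
      show "s x - {i} \<in> faces"
        by (rule subface[OF Suc.prems(1)]) blast
    qed (use i in auto)
  qed
  then obtain z where z: "z \<in> verts G" "sym_diff (s x) (s z) = {i}" by (metis imageE)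
  then have "int (card (sym_diff (s x) (s y))) = int (card (sym_diff (s z) (s y))) + 1"
    using card_sym_diff_flip[OF _ _ z(2), of "s y"] Suc.prems T(3) z(1) by simp
  then have "(adj G ^^ k) z y" using Suc.IH[OF z(1) Suc.prems(2)] Suc.prems(3) by simp
  moreover have "adj G x z" using adj_iff[OF Suc.prems(1) z(1)] z(2) by simp
  ultimately show ?case by (rule relpowp_Suc_I2[rotated])
qed

lemma gdist_eq: "\<lbrakk>x \<in> verts G; y \<in> verts G\<rbrakk> \<Longrightarrow> gdist G x y = card (sym_diff (s x) (s y))"
  unfolding gdist_def by (rule Least_equality) (auto intro: walk_exists walk_length_ge)

text \<open>Moving along an edge of direction \<open>i\<close> changes the distance to a vertex by one, with a sign
  that depends only on whether that vertex contains \<open>i\<close>. The sums in the definition of \<open>\<Theta>\<close> therefore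
  differ iff the two ends of the second edge disagree about \<open>i\<close>.\<close>

lemma gdist_step:
  assumes "x \<in> verts G" "y \<in> verts G" "v \<in> verts G" "sym_diff (s x) (s y) = {i}"
  shows "int (gdist G v x) = int (gdist G v y) + (if i \<in> s x \<longleftrightarrow> i \<in> s v then - 1 else 1)"
  using card_sym_diff_flip[OF _ _ assms(4), of "s v"] assms(1-3) by (simp add: gdist_eq Un_commute)

lemma gdist_commute: "\<lbrakk>x \<in> verts G; y \<in> verts G\<rbrakk> \<Longrightarrow> gdist G x y = gdist G y x"
  by (simp add: gdist_eq Un_commute)

lemma Theta_iff:
  assumes "e \<in> direction i" "f \<in> direction j"
  shows "(e, f) \<in> Theta G \<longleftrightarrow> i = j"
proof -
  have key: "gdist G x1 y1 + gdist G x2 y2 \<noteq> gdist G x1 y2 + gdist G x2 y1 \<longleftrightarrow> i = j"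
    if "e = {x1, x2}" "f = {y1, y2}" for x1 x2 y1 y2
  proof -
    have v: "x1 \<in> verts G" "x2 \<in> verts G" "y1 \<in> verts G" "y2 \<in> verts G"
      using assms that unfolding direction_def by (auto simp: doubleton_eq_iff)
    have d: "sym_diff (s x1) (s x2) = {i}" "sym_diff (s y1) (s y2) = {j}"
      using assms that v pair_in_direction by auto
    have "i = j \<longleftrightarrow> \<not> (i \<in> s y1 \<longleftrightarrow> i \<in> s y2)"
      using mem_sym_diff_singleton[OF d(2), of i] by auto
    moreover have "gdist G x1 y1 = gdist G y1 x1" "gdist G x2 y2 = gdist G y2 x2"
      "gdist G x1 y2 = gdist G y2 x1" "gdist G x2 y1 = gdist G y1 x2"
      using gdist_commute v by auto
    ultimately show ?thesis
      using gdist_step[OF v(1,2) v(3) d(1)] gdist_step[OF v(1,2) v(4) d(1)]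
      by (auto split: if_splits)
  qed
  obtain x1 x2 y1 y2 where "e = {x1, x2}" "f = {y1, y2}"
    using assms unfolding direction_def by blast
  moreover have "e \<in> edges G" "f \<in> edges G"
    using assms edges_eq by auto
  ultimately show ?thesis
    unfolding Theta_def using key by blast
qed

lemma Theta_classes_eq: "Theta_classes G = direction ` points"
proof -
  have cls: "Theta G `` {e} = direction i" if "e \<in> direction i" for e i
  proof (intro equalityI subsetI)
    fix f assume "f \<in> Theta G `` {e}"
    moreover from this obtain j where "f \<in> direction j"
      unfolding Theta_def using edges_eq by auto
    ultimately show "f \<in> direction i" using Theta_iff[OF that] by auto
  qed (use Theta_iff that in blast)
  show ?thesis
  proof (intro equalityI subsetI)
    fix C assume "C \<in> Theta_classes G"
    then obtain e where e: "e \<in> edges G" "C = Theta G `` {e}"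
      unfolding Theta_classes_def by (rule quotientE)
    obtain i where i: "e \<in> direction i" using e(1) edges_eq by auto
    then have "i \<in> points" using direction_nonempty_iff by (metis empty_iff)
    then show "C \<in> direction ` points" using cls[OF i] e(2) by (metis imageI)
  next
    fix C assume "C \<in> direction ` points"
    then obtain i where i: "i \<in> points" "C = direction i" by (rule imageE)
    then obtain e where e: "e \<in> direction i" using direction_nonempty_iff by (metis all_not_in_conv)
    then have "e \<in> edges G" using edges_eq by auto
    then show "C \<in> Theta_classes G"
      unfolding Theta_classes_def i(2) cls[OF e, symmetric] by (rule quotientI)
  qed
qed


section \<open>The \<open>\<tau>\<close>-graph and minimal nonfaces\<close>

text \<open>The witness \<open>T\<close> is the label of the middle vertex. It contains neither \<open>i\<close> nor \<open>j\<close>, because otherwise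
  the fourth corner of the square would arise by removing a point from the label of \<open>u\<close> or \<open>w\<close>
  and would thus be a face.\<close>

lemma convex_path_blocks_square:
  assumes path: "convex_path3 G u v w" and "{u, v} \<in> direction i" "{v, w} \<in> direction j" "i \<noteq> j"
  shows "\<exists>T. insert i T \<in> faces \<and> insert j T \<in> faces \<and> insert i (insert j T) \<notin> faces"
proof -
  have verts: "u \<in> verts G" "v \<in> verts G" "w \<in> verts G"
    using assms(2,3) unfolding direction_def by (auto simp: doubleton_eq_iff)
  have d: "sym_diff (s u) (s v) = {i}" "sym_diff (s v) (s w) = {j}"
    using assms(2,3) verts pair_in_direction by auto
  \<comment> \<open>A fourth corner of the square would be a second common neighbour of \<open>u\<close> and \<open>w\<close>.\<close>
  have no_corner: False
    if T: "T \<in> faces" "sym_diff (s u) T = {j}" "sym_diff T (s w) = {i}" for T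
  proof -
    obtain z where z: "z \<in> verts G" "s z = T" using T(1) by (metis imageE)
    then have "adj G u z" "adj G z w" using T(2,3) adj_iff verts by auto
    then have "z = v" using path unfolding convex_path3_def by blast
    then have "{i} = {j}" using T(2) d(1) z by simp
    then show False using assms(4) by simp
  qed
  note mem_v = mem_sym_diff_singleton[OF d(1)] and mem_w = mem_sym_diff_singleton[OF d(2)]
  have i: "i \<notin> s v"
  proof
    assume "i \<in> s v"
    then have "sym_diff (s u) (s w - {i}) = {j}" "sym_diff (s w - {i}) (s w) = {i}"
      using assms(4) by (auto simp: mem_v mem_w split: if_splits)
    moreover have "s w - {i} \<in> faces"
      by (rule subface[OF verts(3)]) blast
    ultimately show False using no_corner by metis
  qed
  have j: "j \<notin> s v"
  proof
    assume "j \<in> s v"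
    then have "sym_diff (s u) (s u - {j}) = {j}" "sym_diff (s u - {j}) (s w) = {i}"
      using assms(4) by (auto simp: mem_v mem_w split: if_splits)
    moreover have "s u - {j} \<in> faces"
      by (rule subface[OF verts(1)]) blast
    ultimately show False using no_corner by metis
  qed
  have uw: "s u = insert i (s v)" "s w = insert j (s v)"
    using i j mem_v[of i] mem_w[of j] by (auto simp: mem_v mem_w split: if_splits)
  moreover have "insert i (insert j (s v)) \<notin> faces"
  proof
    assume "insert i (insert j (s v)) \<in> faces"
    then show False by (rule no_corner) (use uw i j assms(4) in auto)
  qed
  ultimately show ?thesis using verts by (metis imageI)
qed

lemma tau_adj_nonface:
  assumes "adj (tau_graph G) (direction i) (direction j)"
  shows "\<exists>T. insert i T \<in> faces \<and> insert j T \<in> faces \<and> insert i (insert j T) \<notin> faces"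
proof -
  obtain C D u v w where CD: "{direction i, direction j} = {C, D}" "C \<noteq> D"
    and path: "{u, v} \<in> C" "{v, w} \<in> D" "convex_path3 G u v w"
    using assms unfolding adj_def tau_graph_def by simp metis
  then consider "C = direction i" "D = direction j" | "C = direction j" "D = direction i"
    by (metis doubleton_eq_iff)
  then show ?thesis
  proof cases
    case 1
    with CD(2) path show ?thesis by (intro convex_path_blocks_square) auto
  next
    case 2
    with CD(2) path
    have "\<exists>T. insert j T \<in> faces \<and> insert i T \<in> faces \<and> insert j (insert i T) \<notin> faces"
      by (intro convex_path_blocks_square) auto
    then show ?thesis by (metis insert_commute)
  qed
qed

text \<open>Removing two points from a minimal nonface \<open>N\<close> gives the middle of a convex path: the only
  other candidate for a common neighbour of its ends is \<open>N\<close> itself.\<close>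

lemma minimal_nonface_clique:
  assumes N: "N \<notin> faces" "\<And>k. k \<in> N \<Longrightarrow> N - {k} \<in> faces" and ij: "i \<in> N" "j \<in> N" "i \<noteq> j"
  shows "adj (tau_graph G) (direction i) (direction j)"
proof -
  obtain u w where uw: "u \<in> verts G" "s u = N - {j}" "w \<in> verts G" "s w = N - {i}"
    using N(2)[OF ij(1)] N(2)[OF ij(2)] by (smt (verit) image_iff)
  have "N - {i} - {j} \<in> faces" by (rule subface[OF uw(3)]) (use uw in blast)
  then obtain v where v: "v \<in> verts G" "s v = N - {i} - {j}" by (metis imageE)
  have iuv: "{u, v} \<in> direction i" and jvw: "{v, w} \<in> direction j"
    using uw v ij by (auto simp: pair_in_direction)
  have "u \<noteq> w" using uw ij by auto
  moreover have "\<not> adj G u w"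
  proof
    assume "adj G u w"
    then obtain k where "sym_diff (N - {j}) (N - {i}) = {k}" using adj_iff uw by auto
    moreover have "sym_diff (N - {j}) (N - {i}) = {i, j}" using ij by auto
    ultimately show False using ij(3) by auto
  qed
  moreover have "{x. adj G u x \<and> adj G x w} = {v}"
  proof (intro equalityI subsetI)
    fix x assume "x \<in> {x. adj G u x \<and> adj G x w}"
    then have a: "adj G u x" "adj G x w" by auto
    then have x: "x \<in> verts G" using adj_verts by blast
    obtain k l where kl: "sym_diff (N - {j}) (s x) = {k}" "sym_diff (s x) (N - {i}) = {l}"
      using a adj_iff uw x by metis
    note mem_k = mem_sym_diff_singleton[OF kl(1)] and mem_l = mem_sym_diff_singleton[OF kl(2)]
    have "s x \<noteq> N" using x N(1) by (metis imageI)
    \<comment> \<open>Of \<open>k\<close> and \<open>l\<close> one is \<open>i\<close> and the other is \<open>j\<close>; the order decides between the two candidates.\<close>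
    consider "k = i" "l = j" | "k = j" "l = i"
      using mem_k[of i] mem_l[of i] mem_k[of j] mem_l[of j] ij by (auto split: if_splits)
    then have "s x = s v"
    proof cases
      case 1
      then have "y \<in> s x \<longleftrightarrow> y \<in> N - {i} - {j}" for y
        using mem_k[of y] ij by (auto split: if_splits)
      then show ?thesis using v(2) by blast
    next
      case 2
      then have "y \<in> s x \<longleftrightarrow> y \<in> N" for y
        using mem_k[of y] ij by (auto split: if_splits)
      then have "s x = N" by blast
      with \<open>s x \<noteq> N\<close> show ?thesis by contradiction
    qed
    then have "x = v" by (rule inj_onD[OF inj _ x v(1)])
    then show "x \<in> {v}" by simp
  next
    fix x assume "x \<in> {v}"
    moreover have "adj G u v" "adj G v w"
      using iuv jvw edges_eq by (auto simp: adj_def)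
    ultimately show "x \<in> {x. adj G u x \<and> adj G x w}" by simp
  qed
  ultimately have "convex_path3 G u v w" unfolding convex_path3_def by blast
  moreover have Theta_class: "direction k \<in> Theta_classes G" if "e \<in> direction k" for e k
    using that direction_nonempty_iff[of k] Theta_classes_eq by auto
  have "direction i \<in> Theta_classes G" "direction j \<in> Theta_classes G"
    using Theta_class iuv jvw by auto
  moreover have "direction i \<noteq> direction j"
    using direction_disjoint iuv ij(3) by blast
  ultimately show ?thesis
    unfolding adj_def tau_graph_def using iuv jvw by simp metis
qed

lemma minimal_nonface_exists:
  assumes "finite T" "T \<notin> faces"
  obtains N where "N \<subseteq> T" "N \<notin> faces" "\<And>k. k \<in> N \<Longrightarrow> N - {k} \<in> faces"
  using assms
proof (induction T arbitrary: thesis rule: finite_psubset_induct)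
  case (psubset T)
  show ?case
  proof (cases "\<exists>k\<in>T. T - {k} \<notin> faces")
    case True
    then obtain k where k: "k \<in> T" "T - {k} \<notin> faces" by blast
    show ?thesis
    proof (rule psubset.IH[of "T - {k}"])
      fix N assume "N \<subseteq> T - {k}" "N \<notin> faces" "\<And>k. k \<in> N \<Longrightarrow> N - {k} \<in> faces"
      then show thesis by (intro psubset.prems(1)[of N]) auto
    qed (use k in auto)
  qed (use psubset.prems in blast)
qed

text \<open>A minimal nonface with three points would contain a triangle of the \<open>\<tau>\<close>-graph, so in the forest case
  every minimal nonface consisting of points is a single \<open>\<tau>\<close>-edge.\<close>

lemma tau_adj_pair_nonface:
  assumes "forest (tau_graph G)"
    and "adj (tau_graph G) (direction i) (direction j)"
  shows "{i, j} \<notin> faces"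
proof
  assume pair: "{i, j} \<in> faces"
  obtain T where T: "insert i T \<in> faces" "insert j T \<in> faces" "insert i (insert j T) \<notin> faces"
    using tau_adj_nonface[OF assms(2)] by metis
  have "finite (insert i T)" using T(1) by (metis imageE finite_label)
  then have "finite (insert i (insert j T))" by simp
  then obtain N where N: "N \<subseteq> insert i (insert j T)" "N \<notin> faces"
      "\<And>k. k \<in> N \<Longrightarrow> N - {k} \<in> faces"
    using minimal_nonface_exists[OF _ T(3)] by metis
  have ij: "j \<in> N" "i \<in> N"
    using N(1,2) face_subset[OF T(1), of N] face_subset[OF T(2), of N]
    by (metis subset_insert insert_commute)+
  have "i \<noteq> j" using T by auto
  have "\<not> N \<subseteq> {i, j}" using face_subset[OF pair] N(2) by metis
  then obtain k where k: "k \<in> N" "k \<noteq> i" "k \<noteq> j" by blast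
  have clique: "adj (tau_graph G) (direction a) (direction b) \<and> direction a \<noteq> direction b"
    if "a \<in> N" "b \<in> N" "a \<noteq> b" for a b
  proof
    show "adj (tau_graph G) (direction a) (direction b)"
      by (rule minimal_nonface_clique[OF N(2,3) that])
    have "a \<in> points" "b \<in> points"
      using N(1) T(1,2) that by (metis UnionI insertCI insertE subsetD)+
    then show "direction a \<noteq> direction b"
      using inj_onD[OF inj_on_direction] that(3) by metis
  qed
  let ?c = "[direction i, direction j, direction k]"
  have "3 \<le> length ?c \<and> distinct ?c \<and> successively (adj (tau_graph G)) ?c \<and>
      adj (tau_graph G) (last ?c) (hd ?c)"
    using clique ij k \<open>i \<noteq> j\<close> by simp
  then show False
    using assms(1) unfolding forest_def by metis
qed

text \<open>Conversely, a nonface contains a minimal nonface, which is a clique with at least two points.\<close>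

lemma face_iff_independent:
  assumes "forest (tau_graph G)" "T \<subseteq> points"
  shows "T \<in> faces \<longleftrightarrow> (\<forall>i\<in>T. \<forall>j\<in>T. \<not> adj (tau_graph G) (direction i) (direction j))"
proof
  assume T: "T \<in> faces"
  have "{i, j} \<in> faces" if "i \<in> T" "j \<in> T" for i j
    by (rule face_subset[OF T]) (use that in simp)
  then show "\<forall>i\<in>T. \<forall>j\<in>T. \<not> adj (tau_graph G) (direction i) (direction j)"
    using tau_adj_pair_nonface[OF assms(1)] by metis
next
  assume indep: "\<forall>i\<in>T. \<forall>j\<in>T. \<not> adj (tau_graph G) (direction i) (direction j)"
  show "T \<in> faces"
  proof (rule ccontr)
    assume "T \<notin> faces"
    moreover have "finite T" using assms(2) finite_points by (rule finite_subset)
    ultimately obtain N where N: "N \<subseteq> T" "N \<notin> faces" "\<And>k. k \<in> N \<Longrightarrow> N - {k} \<in> faces"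
      using minimal_nonface_exists by metis
    \<comment> \<open>The empty set and the single points are faces, so \<open>N\<close> has two points.\<close>
    have "N \<noteq> {}" using N(2) min_vertex by (metis imageI)
    then obtain i where i: "i \<in> N" by blast
    then have "i \<in> points" using N(1) assms(2) by (metis subsetD)
    then obtain K where "K \<in> faces" "i \<in> K" by (rule UnionE)
    then have "{i} \<in> faces" using face_subset by simp
    then have "N \<noteq> {i}" using N(2) by metis
    then obtain j where j: "j \<in> N" "i \<noteq> j" using i by blast
    have "adj (tau_graph G) (direction i) (direction j)"
      by (rule minimal_nonface_clique[OF N(2,3) i j])
    then show False using indep i j(1) N(1) by (metis subsetD)
  qed
qed


section \<open>Contractions\<close>

lemma W_set_eq:
  assumes "a \<in> verts G" "b \<in> verts G" "sym_diff (s a) (s b) = {i}"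
  shows "W_set G a b = {v \<in> verts G. i \<in> s v \<longleftrightarrow> i \<in> s a}"
proof -
  have "gdist G v a < gdist G v b \<longleftrightarrow> (i \<in> s v \<longleftrightarrow> i \<in> s a)" if "v \<in> verts G" for v
    using gdist_step[OF assms(1,2) that assms(3)] by (simp split: if_splits)
  then show ?thesis unfolding W_set_def by auto
qed

text \<open>Removing \<open>i\<close> from a face that contains it leads to the other side.\<close>

lemma upper_side_peripheral:
  assumes "a \<in> verts G" "b \<in> verts G" "sym_diff (s a) (s b) = {i}" "i \<notin> s a"
  shows "W_set G b a = U_set G b a"
proof -
  have i_b: "i \<in> s b" using mem_sym_diff_singleton[OF assms(3), of i] assms(4) by simp
  have Wab: "W_set G a b = {v \<in> verts G. i \<notin> s v}"
    using W_set_eq[OF assms(1-3)] assms(4) by simp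
  have Wba: "W_set G b a = {v \<in> verts G. i \<in> s v}"
    using W_set_eq[OF assms(2,1), of i] assms(3) i_b by (simp add: Un_commute)
  have "\<exists>w\<in>verts G. i \<notin> s w \<and> adj G v w" if v: "v \<in> verts G" "i \<in> s v" for v
  proof -
    have "s v - {i} \<in> faces" by (rule subface[OF v(1)]) blast
    then obtain w where w: "w \<in> verts G" "s w = s v - {i}" by (metis imageE)
    then have "sym_diff (s v) (s w) = {i}" using v(2) by auto
    then have "adj G v w" using adj_iff[OF v(1) w(1)] by simp
    then show ?thesis using w by auto
  qed
  then show ?thesis unfolding U_set_def Wab Wba by auto
qed

text \<open>The side of the empty face consists of the faces that avoid \<open>i\<close>, whichever edge of direction \<open>i\<close>
  is used; hence the definite description has exactly one candidate.\<close>

lemma contraction_eq: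
  assumes "i \<in> points"
  shows "contraction G m (direction i) = induced G {x \<in> verts G. i \<notin> s x}"
  unfolding contraction_def
proof (rule the_equality)
  obtain e where "e \<in> direction i" using assms direction_nonempty_iff by (metis all_not_in_conv)
  then obtain a b where ab: "a \<in> verts G" "b \<in> verts G" "sym_diff (s a) (s b) = {i}"
    unfolding direction_def by blast
  have side: "W_set G a b = {x \<in> verts G. i \<notin> s x}" if "i \<notin> s a" "a \<in> verts G" "b \<in> verts G"
    "sym_diff (s a) (s b) = {i}" for a b
    using W_set_eq[OF that(2-4)] that(1) by simp
  have "\<exists>a b. a \<in> verts G \<and> b \<in> verts G \<and> sym_diff (s a) (s b) = {i} \<and> i \<notin> s a"
  proof (cases "i \<in> s a")
    case True
    then have "i \<notin> s b" using mem_sym_diff_singleton[OF ab(3), of i] by simp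
    moreover have "sym_diff (s b) (s a) = {i}" using ab(3) by (simp add: Un_commute)
    ultimately show ?thesis using ab(1,2) by metis
  qed (use ab in metis)
  then obtain a b where ab: "a \<in> verts G" "b \<in> verts G" "sym_diff (s a) (s b) = {i}" "i \<notin> s a"
    by metis
  show "\<exists>a b. {a, b} \<in> direction i \<and> W_set G b a = U_set G b a \<and> m \<in> W_set G a b \<and>
          induced G {x \<in> verts G. i \<notin> s x} = induced G (W_set G a b)"
  proof (intro exI conjI)
    show "{a, b} \<in> direction i" using ab(3) pair_in_direction[OF ab(1,2)] by simp
    show "W_set G b a = U_set G b a" by (rule upper_side_peripheral[OF ab])
    show "m \<in> W_set G a b" using side[OF ab(4,1,2,3)] min_vertex by simp
    show "induced G {x \<in> verts G. i \<notin> s x} = induced G (W_set G a b)" using side[OF ab(4,1,2,3)] by simp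
  qed
  fix H
  assume "\<exists>a b. {a, b} \<in> direction i \<and> W_set G b a = U_set G b a \<and> m \<in> W_set G a b \<and>
            H = induced G (W_set G a b)"
  then obtain a b where ab: "{a, b} \<in> direction i" "m \<in> W_set G a b" "H = induced G (W_set G a b)"
    by blast
  have v: "a \<in> verts G" "b \<in> verts G"
    using ab(1) unfolding direction_def by (auto simp: doubleton_eq_iff)
  then have d: "sym_diff (s a) (s b) = {i}" using ab(1) pair_in_direction by simp
  have "i \<notin> s a" using W_set_eq[OF v d] ab(2) min_vertex(2) by simp
  then show "H = induced G {x \<in> verts G. i \<notin> s x}" using side[OF _ v d] ab(3) by simp
qed

end


section \<open>A daisy cube as the independent sets of its \<open>\<tau>\<close>-graph\<close>

lemma sym_diff_image_eq_singleton:
  assumes f: "inj_on f D" and PQ: "P \<subseteq> D" "Q \<subseteq> D" and c: "c \<in> D"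
  shows "sym_diff (f ` P) (f ` Q) = {f c} \<longleftrightarrow> sym_diff P Q = {c}"
proof -
  have "P - Q \<subseteq> D" "Q - P \<subseteq> D" using PQ by blast+
  then have "sym_diff (f ` P) (f ` Q) = f ` sym_diff P Q"
    using inj_on_image_set_diff[OF f _ PQ(2)] inj_on_image_set_diff[OF f _ PQ(1)]
    by (simp add: image_Un)
  moreover have "f ` sym_diff P Q = f ` {c} \<longleftrightarrow> sym_diff P Q = {c}"
    by (rule inj_on_image_eq_iff[OF f]) (use PQ c in blast)+
  ultimately show ?thesis by simp
qed

definition independent_sets :: "'a sgraph \<Rightarrow> 'a set set" where
  "independent_sets H = {T. T \<subseteq> verts H \<and> (\<forall>x\<in>T. \<forall>y\<in>T. \<not> adj H x y)}"

definition ones :: "bool list \<Rightarrow> nat set" where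
  "ones u = {i. i < length u \<and> u ! i}"

lemma ones_inject: "\<lbrakk>length u = length v; ones u = ones v\<rbrakk> \<Longrightarrow> u = v"
proof (rule nth_equalityI)
  fix i assume uv: "length u = length v" "ones u = ones v" "i < length u"
  then have "i \<in> ones u \<longleftrightarrow> i \<in> ones v" by simp
  then show "u ! i = v ! i" using uv(1,3) by (simp add: ones_def)
qed

lemma verts_daisy: "verts (daisy h X) = {u. length u = h \<and> (\<exists>x\<in>X. list_all2 (\<le>) u x)}"
  by (auto simp: daisy_def induced_def hypercube_def binary_strings_def)

lemma adj_daisy_iff:
  assumes "u \<in> verts (daisy h X)" "v \<in> verts (daisy h X)"
  shows "adj (daisy h X) u v \<longleftrightarrow> (\<exists>i. sym_diff (ones u) (ones v) = {i})"
proof -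
  have len: "length u = h" "length v = h" using assms by (auto simp: verts_daisy)
  have diff: "{i. i < h \<and> u ! i \<noteq> v ! i} = sym_diff (ones u) (ones v)"
    if "length u = h" "length v = h" for u v
    using that by (auto simp: ones_def)
  have in_daisy: "\<exists>x\<in>X. list_all2 (\<le>) u x" "\<exists>x\<in>X. list_all2 (\<le>) v x"
    using assms by (auto simp: verts_daisy)
  have "{u, v} \<in> edges (daisy h X) \<longleftrightarrow> (\<exists>u' v'. {u, v} = {u', v'} \<and> length u' = h \<and>
      length v' = h \<and> card (sym_diff (ones u') (ones v')) = 1)"
    using in_daisy diff by (simp add: daisy_def induced_def hypercube_def binary_strings_def cong: conj_cong)
  also have "\<dots> \<longleftrightarrow> card (sym_diff (ones u) (ones v)) = 1"
    using len by (metis doubleton_eq_iff Un_commute)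
  finally show ?thesis unfolding adj_def by (simp add: card_1_singleton_iff)
qed

lemma daisy_face_subset:
  assumes "u \<in> verts (daisy h X)" "T \<subseteq> ones u"
  shows "T \<in> ones ` verts (daisy h X)"
proof -
  let ?t = "map (\<lambda>i. i \<in> T) [0..<h]"
  obtain x where x: "x \<in> X" "list_all2 (\<le>) u x" "length u = h" using assms by (auto simp: verts_daisy)
  have "list_all2 (\<le>) ?t u" using assms(2) x(3) by (auto simp: list_all2_conv_all_nth ones_def)
  then have "list_all2 (\<le>) ?t x" using x(2) by (rule list_all2_trans[rotated]) auto
  then have "?t \<in> verts (daisy h X)" using x(1) by (auto simp: verts_daisy)
  moreover have "ones ?t = T" using assms(2) x(3) by (auto simp: ones_def)
  ultimately show ?thesis by blast
qed

lemma daisy_cube_face_labelling: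
  assumes "daisy_cube_with_min G m"
  shows "\<exists>s :: 'a \<Rightarrow> nat set. face_labelling G s m"
proof -
  obtain h X f where X: "X \<noteq> {}" "X \<subseteq> binary_strings h" and f: "graph_iso f (daisy h X) G"
    and m: "m = f (replicate h False)" and simple: "simple_graph G"
    using assms unfolding daisy_cube_with_min_def by blast
  let ?V = "verts (daisy h X)"
  define g where "g = inv_into ?V f"
  have bij: "bij_betw f ?V (verts G)" using f by (simp add: graph_iso_def)
  then have bijg: "bij_betw g (verts G) ?V" unfolding g_def by (rule bij_betw_inv_into)
  have gV: "g x \<in> ?V" if "x \<in> verts G" for x using bijg that by (rule bij_betw_apply)
  have fg: "f (g x) = x" if "x \<in> verts G" for x
    using bij that unfolding g_def by (rule bij_betw_inv_into_right)
  have img: "g ` verts G = ?V" using bijg by (rule bij_betw_imp_surj_on)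
  have zero: "replicate h False \<in> ?V"
    using X by (fastforce simp: verts_daisy list_all2_conv_all_nth binary_strings_def)
  have "face_labelling G (\<lambda>x. ones (g x)) m"
  proof
    show "simple_graph G" by (rule simple)
    show "inj_on (\<lambda>x. ones (g x)) (verts G)"
    proof (rule inj_onI)
      fix x y assume xy: "x \<in> verts G" "y \<in> verts G" "ones (g x) = ones (g y)"
      then have "g x = g y" using gV ones_inject by (force simp: verts_daisy)
      then show "x = y" using fg xy by metis
    qed
    show "adj G x y \<longleftrightarrow> (\<exists>i. sym_diff (ones (g x)) (ones (g y)) = {i})"
      if "x \<in> verts G" "y \<in> verts G" for x y
      using f adj_daisy_iff[OF gV[OF that(1)] gV[OF that(2)]] gV fg that
      unfolding graph_iso_def by metis
    show "T \<in> (\<lambda>x. ones (g x)) ` verts G" if "x \<in> verts G" "T \<subseteq> ones (g x)" for x T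
      using daisy_face_subset[OF gV[OF that(1)] that(2)] by (simp add: img[symmetric] image_image)
    have "\<Union> ((\<lambda>x. ones (g x)) ` verts G) \<subseteq> {..<h}"
      using gV by (fastforce simp: ones_def verts_daisy)
    then show "finite (\<Union> ((\<lambda>x. ones (g x)) ` verts G))" by (rule finite_subset) simp
    show "m \<in> verts G" using m zero bij by (simp add: bij_betw_apply)
    have "g m = replicate h False"
      unfolding m g_def using bij zero by (rule bij_betw_inv_into_left)
    then show "ones (g m) = {}" by (auto simp: ones_def)
  qed
  then show ?thesis by blast
qed

text \<open>Everything the theorem speaks of is expressed here by the labelling and the \<open>\<tau>\<close>-graph alone, so
  that it can be carried along an isomorphism of \<open>\<tau>\<close>-graphs.\<close>

lemma independent_set_labelling:
  assumes "daisy_cube_with_min G m" "forest (tau_graph G)"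
  obtains S where
    "bij_betw S (verts G) (independent_sets (tau_graph G))"
    "\<And>x y C. \<lbrakk>x \<in> verts G; y \<in> verts G; C \<in> Theta_classes G\<rbrakk> \<Longrightarrow>
       {x, y} \<in> C \<longleftrightarrow> sym_diff (S x) (S y) = {C}"
    "edges G = \<Union> (Theta_classes G)"
    "\<And>C. C \<in> Theta_classes G \<Longrightarrow> contraction G m C = induced G {x \<in> verts G. C \<notin> S x}"
proof -
  obtain s :: "'a \<Rightarrow> nat set" where "face_labelling G s m"
    using daisy_cube_face_labelling[OF assms(1)] by blast
  then interpret face_labelling G s m .
  let ?S = "\<lambda>x. direction ` s x"
  have sub: "s x \<subseteq> points" if "x \<in> verts G" for x using that by (rule UN_upper)
  have "bij_betw (image direction) faces (independent_sets (tau_graph G))"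
    unfolding bij_betw_def
  proof
    show "inj_on (image direction) faces"
      using inj_on_image_eq_iff[OF inj_on_direction] by (intro inj_onI) (metis Union_upper)
    show "image direction ` faces = independent_sets (tau_graph G)"
    proof (intro equalityI subsetI)
      fix K assume "K \<in> image direction ` faces"
      then obtain T where T: "T \<in> faces" "K = direction ` T" by blast
      then have "T \<subseteq> points" by (simp add: Union_upper)
      then show "K \<in> independent_sets (tau_graph G)"
        using face_iff_independent[OF assms(2)] T
        by (auto simp: independent_sets_def tau_graph_def Theta_classes_eq)
    next
      fix K assume K: "K \<in> independent_sets (tau_graph G)"
      then have "K \<subseteq> direction ` points"
        by (simp add: independent_sets_def tau_graph_def Theta_classes_eq)
      then obtain T where T: "T \<subseteq> points" "K = direction ` T"
        by (rule subset_imageE)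
      then have "T \<in> faces"
        using K face_iff_independent[OF assms(2)] by (auto simp: independent_sets_def)
      then show "K \<in> image direction ` faces" using T by blast
    qed
  qed
  then have 1: "bij_betw ?S (verts G) (independent_sets (tau_graph G))"
    using bij_betw_trans[OF inj_on_imp_bij_betw[OF inj]] by (simp add: comp_def)
  have 2: "{x, y} \<in> C \<longleftrightarrow> sym_diff (?S x) (?S y) = {C}"
    if xy: "x \<in> verts G" "y \<in> verts G" "C \<in> Theta_classes G" for x y C
  proof -
    obtain i where i: "i \<in> points" "C = direction i" using xy(3) Theta_classes_eq by (metis imageE)
    then show ?thesis
      using pair_in_direction[OF xy(1,2)]
        sym_diff_image_eq_singleton[OF inj_on_direction sub[OF xy(1)] sub[OF xy(2)]] by simp
  qed
  have 3: "edges G = \<Union> (Theta_classes G)"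
  proof (intro equalityI subsetI)
    fix e assume "e \<in> edges G"
    then obtain i where i: "e \<in> direction i" unfolding edges_eq by (rule UN_E)
    then have "direction i \<noteq> {}" by (metis empty_iff)
    then have "i \<in> points" by (simp only: direction_nonempty_iff)
    then have "direction i \<in> Theta_classes G" unfolding Theta_classes_eq by (rule imageI)
    then show "e \<in> \<Union> (Theta_classes G)" using i by (rule UnionI)
  next
    fix e assume "e \<in> \<Union> (Theta_classes G)"
    then obtain C where "C \<in> Theta_classes G" "e \<in> C" by (rule UnionE)
    moreover from this(1) obtain i where "C = direction i" unfolding Theta_classes_eq by (rule imageE)
    ultimately have "e \<in> direction i" by simp
    then show "e \<in> edges G" unfolding edges_eq by (rule UN_I[OF UNIV_I])
  qed
  have 4: "contraction G m C = induced G {x \<in> verts G. C \<notin> ?S x}" if C: "C \<in> Theta_classes G" for C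
  proof -
    obtain i where i: "C = direction i" "i \<in> points"
      using C unfolding Theta_classes_eq by (rule imageE)
    then have "C \<in> ?S x \<longleftrightarrow> i \<in> s x" if "x \<in> verts G" for x
      using inj_on_image_mem_iff[OF inj_on_direction i(2) sub[OF that]] by simp
    then have "{x \<in> verts G. C \<notin> ?S x} = {x \<in> verts G. i \<notin> s x}" by (simp cong: conj_cong)
    then show ?thesis using contraction_eq[OF i(2)] i(1) by simp
  qed
  show thesis by (rule that[OF 1 2 3 4])
qed


section \<open>Isomorphisms of \<open>\<tau>\<close>-graphs induce isomorphisms of daisy cubes\<close>

lemma graph_iso_image_independent_sets:
  assumes "graph_iso f G H"
  shows "bij_betw (image f) (independent_sets G) (independent_sets H)"
proof -
  have bij: "bij_betw f (verts G) (verts H)"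
    and adj: "\<And>u v. \<lbrakk>u \<in> verts G; v \<in> verts G\<rbrakk> \<Longrightarrow> adj G u v \<longleftrightarrow> adj H (f u) (f v)"
    using assms unfolding graph_iso_def by auto
  have iff: "T \<in> independent_sets G \<longleftrightarrow> f ` T \<in> independent_sets H" if "T \<in> Pow (verts G)" for T
  proof -
    have "f ` T \<subseteq> verts H" using that bij by (auto dest: bij_betw_apply)
    moreover have "adj G x y \<longleftrightarrow> adj H (f x) (f y)" if "x \<in> T" "y \<in> T" for x y
      using that \<open>T \<in> Pow (verts G)\<close> adj by blast
    ultimately show ?thesis using that by (auto simp: independent_sets_def)
  qed
  have pow: "bij_betw (image f) (Pow (verts G)) (Pow (verts H))"
    using bij by (rule bij_betw_Pow)
  have "image f ` independent_sets G = independent_sets H"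
  proof (intro equalityI subsetI)
    fix K assume K: "K \<in> independent_sets H"
    then have "K \<in> image f ` Pow (verts G)"
      using bij_betw_imp_surj_on[OF pow] by (auto simp: independent_sets_def)
    then show "K \<in> image f ` independent_sets G" using iff K by blast
  qed (use iff in \<open>auto simp: independent_sets_def\<close>)
  moreover have "independent_sets G \<subseteq> Pow (verts G)" by (auto simp: independent_sets_def)
  ultimately show ?thesis by (rule bij_betw_subset[OF pow, rotated])
qed

lemma graph_iso_induced:
  assumes "graph_iso f G H" "\<And>x. x \<in> verts G \<Longrightarrow> x \<in> S \<longleftrightarrow> f x \<in> S'"
  shows "graph_iso f (induced G S) (induced H S')"
proof -
  have bij: "bij_betw f (verts G) (verts H)"
    and adj: "\<And>u v. \<lbrakk>u \<in> verts G; v \<in> verts G\<rbrakk> \<Longrightarrow> adj G u v \<longleftrightarrow> adj H (f u) (f v)"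
    using assms(1) unfolding graph_iso_def by auto
  have "f ` (verts G \<inter> S) = verts H \<inter> S'"
    unfolding bij_betw_imp_surj_on[OF bij, symmetric] using assms(2) by auto
  then have "bij_betw f (verts G \<inter> S) (verts H \<inter> S')"
    by (rule bij_betw_subset[OF bij inf_le1])
  then show ?thesis
    using adj assms(2) unfolding graph_iso_def by (simp add: induced_def adj_def) blast
qed

theorem theorem3p2:
  fixes A :: "'a sgraph" and B :: "'b sgraph"
    and a0 :: 'a and b0 :: 'b
    and n :: nat
    and E :: "nat \<Rightarrow> 'a set set" and F :: "nat \<Rightarrow> 'b set set"
    and \<Upsilon> :: "'a set set \<Rightarrow> 'b set set"
  assumes "daisy_cube_with_min A a0" and "daisy_cube_with_min B b0"
    and "forest (tau_graph A)" and "forest (tau_graph B)"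
    and "bij_betw E {1..n} (Theta_classes A)"
    and "bij_betw F {1..n} (Theta_classes B)"
    and "graph_iso \<Upsilon> (tau_graph A) (tau_graph B)"
    and "\<forall>i\<in>{1..n}. \<Upsilon> (E i) = F i"
  shows "\<exists>l. graph_iso l A B \<and>
           (\<forall>i\<in>{1..n}. \<forall>u\<in>verts A. \<forall>v\<in>verts A. {u, v} \<in> E i \<longleftrightarrow> {l u, l v} \<in> F i) \<and>
           (\<forall>j\<in>{1..n}. graph_iso l (contraction A a0 (E j)) (contraction B b0 (F j)))"
proof -
  obtain S where S: "bij_betw S (verts A) (independent_sets (tau_graph A))"
    and S_edge: "\<And>x y C. \<lbrakk>x \<in> verts A; y \<in> verts A; C \<in> Theta_classes A\<rbrakk> \<Longrightarrow>
       {x, y} \<in> C \<longleftrightarrow> sym_diff (S x) (S y) = {C}"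
    and edges_A: "edges A = \<Union> (Theta_classes A)"
    and S_contr: "\<And>C. C \<in> Theta_classes A \<Longrightarrow>
       contraction A a0 C = induced A {x \<in> verts A. C \<notin> S x}"
    by (rule independent_set_labelling[OF assms(1,3)]) blast
  obtain R where R: "bij_betw R (verts B) (independent_sets (tau_graph B))"
    and R_edge: "\<And>x y C. \<lbrakk>x \<in> verts B; y \<in> verts B; C \<in> Theta_classes B\<rbrakk> \<Longrightarrow>
       {x, y} \<in> C \<longleftrightarrow> sym_diff (R x) (R y) = {C}"
    and edges_B: "edges B = \<Union> (Theta_classes B)"
    and R_contr: "\<And>C. C \<in> Theta_classes B \<Longrightarrow>
       contraction B b0 C = induced B {x \<in> verts B. C \<notin> R x}"
    by (rule independent_set_labelling[OF assms(2,4)]) blast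
  have bij_\<Upsilon>: "bij_betw \<Upsilon> (Theta_classes A) (Theta_classes B)"
    using assms(7) by (simp add: graph_iso_def tau_graph_def)
  then have inj_\<Upsilon>: "inj_on \<Upsilon> (Theta_classes A)" by (rule bij_betw_imp_inj_on)
  define l where "l = inv_into (verts B) R \<circ> (image \<Upsilon> \<circ> S)"
  have bij_l: "bij_betw l (verts A) (verts B)"
    unfolding l_def
    by (intro bij_betw_trans[OF bij_betw_trans[OF S graph_iso_image_independent_sets[OF assms(7)]]]
        bij_betw_inv_into[OF R])
  have lB: "l x \<in> verts B" if "x \<in> verts A" for x using bij_l that by (rule bij_betw_apply)
  have R_l: "R (l x) = \<Upsilon> ` S x" if "x \<in> verts A" for x
  proof -
    have "\<Upsilon> ` S x \<in> independent_sets (tau_graph B)"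
      using bij_betw_apply[OF graph_iso_image_independent_sets[OF assms(7)]] bij_betw_apply[OF S that]
      by blast
    then show ?thesis unfolding l_def using bij_betw_inv_into_right[OF R] by simp
  qed
  have S_sub: "S x \<subseteq> Theta_classes A" if "x \<in> verts A" for x
    using bij_betw_apply[OF S that] by (simp add: independent_sets_def tau_graph_def)
  have edge: "{x, y} \<in> C \<longleftrightarrow> {l x, l y} \<in> \<Upsilon> C"
    if xy: "x \<in> verts A" "y \<in> verts A" and C: "C \<in> Theta_classes A" for x y C
    using S_edge[OF xy C] R_edge[OF lB[OF xy(1)] lB[OF xy(2)] bij_betw_apply[OF bij_\<Upsilon> C]]
      sym_diff_image_eq_singleton[OF inj_\<Upsilon> S_sub[OF xy(1)] S_sub[OF xy(2)] C] R_l xy by simp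
  have "adj A x y \<longleftrightarrow> adj B (l x) (l y)" if "x \<in> verts A" "y \<in> verts A" for x y
    unfolding adj_def edges_A edges_B bij_betw_imp_surj_on[OF bij_\<Upsilon>, symmetric]
    using edge[OF that] by blast
  then have iso: "graph_iso l A B" using bij_l by (simp add: graph_iso_def)
  have E: "E i \<in> Theta_classes A" "\<Upsilon> (E i) = F i" if "i \<in> {1..n}" for i
    using bij_betw_apply[OF assms(5) that] assms(8) that by auto
  have "graph_iso l (contraction A a0 (E j)) (contraction B b0 (F j))" if j: "j \<in> {1..n}" for j
  proof -
    have "E j \<in> S x \<longleftrightarrow> F j \<in> R (l x)" if "x \<in> verts A" for x
      using inj_on_image_mem_iff[OF inj_\<Upsilon> E(1)[OF j] S_sub[OF that]] E(2)[OF j] R_l[OF that] by simp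
    then show ?thesis
      unfolding S_contr[OF E(1)[OF j]] R_contr[OF bij_betw_apply[OF assms(6) j]]
      by (intro graph_iso_induced[OF iso]) (simp add: lB)
  qed
  then show ?thesis using iso edge E by metis
qed

end
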